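(* Let $G$ be a finite group, $R$ the ring of integers in a number field $F$ and $[\beta]\in H^2(G,R^* )$. If $x=\sum_{g\in G}a_gu_g$ is a torsion unit in $R^\beta[G]$ such that $a_1\neq0$, then $x\in\mathcal{U}(R)$.
   Context: $H^2(G,R^* )$ is with respect to the trivial action; $\beta$ is a normalized representative ($\beta(1,g)=\beta(g,1)=1$). $R^\beta[G]$ is the twisted group ring: free $R$-module with basis $\{u_g\}_{g\in G}$ and $u_gu_h=\beta(g,h)u_{gh}$, $u_g$ commuting with $R$; $u_1$ is its identity and $R$ is identified with $Ru_1$. A torsion unit is a unit of finite multiplicative order. *)

theory Defs
  imports "HOL-Algebra.Algebra" "HOL-Algebra.Algebraic_Closure_Type"
begin

section \<open>Number fields and their rings of integers\<close>

text \<open>A number field is given as a subfield \<open>F\<close> of an arbitrary ambient field of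
  characteristic 0, which may be \<open>F\<close> itself; \<open>\<rat>\<close> is the prime field of the ambient field.\<close>

definition number_field :: "'a::field_char_0 set \<Rightarrow> bool" where
  "number_field F \<longleftrightarrow>
     subfield F (ring_of_type_algebra :: 'a ring) \<and>
     ring.finite_dimension (ring_of_type_algebra :: 'a ring) \<rat> F"

definition ring_of_integers :: "'a::field_char_0 set \<Rightarrow> 'a ring" where
  "ring_of_integers F = ring_of_type_algebra \<lparr>carrier := {x \<in> F. algebraic_int x}\<rparr>"


section \<open>Second cohomology with trivial action\<close>

text \<open>The coefficient group \<open>A\<close> is abelian and written multiplicatively. Cochains are extensional
  functions on \<open>G \<times> G\<close>, so that equality of cochains is equality of functions.\<close>

definition cocycles2 :: "('g, 'm) monoid_scheme \<Rightarrow> ('a, 'n) monoid_scheme \<Rightarrow> ('g \<times> 'g \<Rightarrow> 'a) monoid"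
  where
  "cocycles2 G A =
     \<lparr>carrier = {\<beta> \<in> carrier G \<times> carrier G \<rightarrow>\<^sub>E carrier A.
         \<forall>g\<in>carrier G. \<forall>h\<in>carrier G. \<forall>k\<in>carrier G.
           \<beta> (g, h) \<otimes>\<^bsub>A\<^esub> \<beta> (g \<otimes>\<^bsub>G\<^esub> h, k) = \<beta> (h, k) \<otimes>\<^bsub>A\<^esub> \<beta> (g, h \<otimes>\<^bsub>G\<^esub> k)},
      monoid.mult = (\<lambda>\<alpha> \<beta>. \<lambda>p\<in>carrier G \<times> carrier G. \<alpha> p \<otimes>\<^bsub>A\<^esub> \<beta> p),
      monoid.one = (\<lambda>p\<in>carrier G \<times> carrier G. \<one>\<^bsub>A\<^esub>)\<rparr>"

definition coboundary2 ::
  "('g, 'm) monoid_scheme \<Rightarrow> ('a, 'n) monoid_scheme \<Rightarrow> ('g \<Rightarrow> 'a) \<Rightarrow> 'g \<times> 'g \<Rightarrow> 'a" where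
  "coboundary2 G A l =
     (\<lambda>(g, h)\<in>carrier G \<times> carrier G. l g \<otimes>\<^bsub>A\<^esub> l h \<otimes>\<^bsub>A\<^esub> inv\<^bsub>A\<^esub> l (g \<otimes>\<^bsub>G\<^esub> h))"

definition H2 ::
  "('g, 'm) monoid_scheme \<Rightarrow> ('a, 'n) monoid_scheme \<Rightarrow> ('g \<times> 'g \<Rightarrow> 'a) set monoid" where
  "H2 G A = cocycles2 G A Mod (coboundary2 G A ` (carrier G \<rightarrow> carrier A))"

definition normalized_cochain2 ::
  "('g, 'm) monoid_scheme \<Rightarrow> ('a, 'n) monoid_scheme \<Rightarrow> ('g \<times> 'g \<Rightarrow> 'a) \<Rightarrow> bool" where
  "normalized_cochain2 G A \<beta> \<longleftrightarrow>
     (\<forall>g\<in>carrier G. \<beta> (\<one>\<^bsub>G\<^esub>, g) = \<one>\<^bsub>A\<^esub> \<and> \<beta> (g, \<one>\<^bsub>G\<^esub>) = \<one>\<^bsub>A\<^esub>)"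


section \<open>Twisted group rings\<close>

definition tgr_basis ::
  "('a, 'n) ring_scheme \<Rightarrow> ('g, 'm) monoid_scheme \<Rightarrow> 'g \<Rightarrow> 'g \<Rightarrow> 'a" where
  "tgr_basis R G g = (\<lambda>h\<in>carrier G. if h = g then \<one>\<^bsub>R\<^esub> else \<zero>\<^bsub>R\<^esub>)"

text \<open>The twisted group ring of a finite group \<open>G\<close> (finiteness makes every coefficient function
  an element of the free module and every sum below finite). An element is its coefficient
  function with respect to the basis \<^const>\<open>tgr_basis\<close>, and the product is the \<open>R\<close>-bilinear
  extension of \<open>u\<^sub>g u\<^sub>h = \<beta>(g,h) u\<^bsub>gh\<^esub>\<close>. The unit is \<open>u\<^sub>1\<close>, which
  presupposes that \<open>\<beta>\<close> is normalized.\<close>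

definition twisted_group_ring ::
  "('a, 'n) ring_scheme \<Rightarrow> ('g, 'm) monoid_scheme \<Rightarrow> ('g \<times> 'g \<Rightarrow> 'a) \<Rightarrow> ('a, 'g \<Rightarrow> 'a) module"
  where
  "twisted_group_ring R G \<beta> =
     \<lparr>carrier = carrier G \<rightarrow>\<^sub>E carrier R,
      monoid.mult = (\<lambda>a b. \<lambda>k\<in>carrier G.
        finsum R (\<lambda>(g, h). a g \<otimes>\<^bsub>R\<^esub> b h \<otimes>\<^bsub>R\<^esub> \<beta> (g, h))
          {(g, h) \<in> carrier G \<times> carrier G. g \<otimes>\<^bsub>G\<^esub> h = k}),
      monoid.one = tgr_basis R G \<one>\<^bsub>G\<^esub>,
      ring.zero = (\<lambda>g\<in>carrier G. \<zero>\<^bsub>R\<^esub>),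
      ring.add = (\<lambda>a b. \<lambda>g\<in>carrier G. a g \<oplus>\<^bsub>R\<^esub> b g),
      module.smult = (\<lambda>r a. \<lambda>g\<in>carrier G. r \<otimes>\<^bsub>R\<^esub> a g)\<rparr>"

definition torsion_unit :: "('a, 'm) monoid_scheme \<Rightarrow> 'a \<Rightarrow> bool" where
  "torsion_unit S x \<longleftrightarrow> x \<in> Units S \<and> (\<exists>n::nat. n > 0 \<and> x [^]\<^bsub>S\<^esub> n = \<one>\<^bsub>S\<^esub>)"

end

theory Submission
  imports Defs "Jordan_Normal_Form.Schur_Decomposition"
begin

text \<open>Left multiplication by \<open>x\<close> on the basis \<open>u\<close> has matrix trace \<open>|G| a\<^sub>1\<close>,
  because \<open>u\<^sub>g\<close> permutes the basis lines without fixed points for \<open>g \<noteq> 1\<close>. Under any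
  embedding \<open>\<sigma>\<close> of the field generated by the coefficients of \<open>x\<close> and the values of \<open>\<beta>\<close>
  into \<open>\<complex>\<close> this matrix has finite order, so its eigenvalues are roots of unity and
  \<open>|\<sigma> a\<^sub>1| \<le> 1\<close>. All conjugates of the nonzero algebraic integer \<open>a\<^sub>1\<close> are thus bounded by 1,
  while their product is a nonzero rational integer; hence \<open>|\<sigma> a\<^sub>1| = 1\<close> for some \<open>\<sigma>\<close>. Then all
  eigenvalues coincide, and a matrix of finite order with a single eigenvalue is scalar.
  So \<open>x = a\<^sub>1 u\<^sub>1\<close> with \<open>a\<^sub>1\<close> a root of unity.\<close>

section \<open>Matrices of finite order\<close>

definition mat_trace :: "'a::comm_monoid_add mat \<Rightarrow> 'a" where
  "mat_trace A = (\<Sum>i<dim_row A. A $$ (i, i))"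

lemma mat_trace_mult_commute:
  fixes A B :: "'a::comm_semiring_0 mat"
  assumes "A \<in> carrier_mat n m" "B \<in> carrier_mat m n"
  shows "mat_trace (A * B) = mat_trace (B * A)"
proof -
  have "mat_trace (A * B) = (\<Sum>i<n. \<Sum>j<m. A $$ (i, j) * B $$ (j, i))"
    using assms by (simp add: mat_trace_def scalar_prod_def atLeast0LessThan)
  also have "\<dots> = (\<Sum>j<m. \<Sum>i<n. B $$ (j, i) * A $$ (i, j))"
    by (subst sum.swap) (simp add: mult.commute)
  also have "\<dots> = mat_trace (B * A)"
    using assms by (simp add: mat_trace_def scalar_prod_def atLeast0LessThan)
  finally show ?thesis .
qed

lemma mat_trace_similar:
  fixes A B :: "'a::comm_ring_1 mat"
  assumes "similar_mat_wit A B P Q"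
  shows "mat_trace A = mat_trace B"
proof -
  note D = similar_mat_witD[OF refl assms]
  have "mat_trace A = mat_trace (P * (B * Q))"
    using D(3) assoc_mult_mat[OF D(6) D(5) D(7)] by simp
  also have "\<dots> = mat_trace (B * Q * P)"
    by (rule mat_trace_mult_commute[OF D(6) mult_carrier_mat[OF D(5) D(7)]])
  also have "B * Q * P = B"
    using D(2) assoc_mult_mat[OF D(5) D(7) D(6)] D(5) by simp
  finally show ?thesis .
qed

text \<open>For \<open>d = 1\<close> the band condition says that \<open>T\<close> is upper triangular.\<close>

lemma banded_pow_mat:
  fixes T :: "'a::comm_ring_1 mat"
  assumes T: "T \<in> carrier_mat N N" and "d > 0"
    and band: "\<And>i j. i < N \<Longrightarrow> j < N \<Longrightarrow> i \<noteq> j \<Longrightarrow> j < i + d \<Longrightarrow> T $$ (i, j) = 0"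
  shows "i < N \<Longrightarrow> j < N \<Longrightarrow> i \<noteq> j \<Longrightarrow> j < i + d \<Longrightarrow> (T ^\<^sub>m k) $$ (i, j) = 0"
    and "i < N \<Longrightarrow> (T ^\<^sub>m k) $$ (i, i) = T $$ (i, i) ^ k"
    and "i + d < N \<Longrightarrow> (\<And>i. i < N \<Longrightarrow> T $$ (i, i) = s) \<Longrightarrow>
           (T ^\<^sub>m k) $$ (i, i + d) = of_nat k * s ^ (k - 1) * T $$ (i, i + d)"
proof -
  have Tk: "T ^\<^sub>m k \<in> carrier_mat N N" for k using T by simp
  have step: "(T ^\<^sub>m Suc k) $$ (i, j) = (\<Sum>l<N. (T ^\<^sub>m k) $$ (i, l) * T $$ (l, j))"
    if "i < N" "j < N" for i j k
    using that T Tk[of k] by (simp add: scalar_prod_def atLeast0LessThan)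
  have off: "(T ^\<^sub>m k) $$ (i, j) = 0" if "i < N" "j < N" "i \<noteq> j" "j < i + d" for i j k
    using that
  proof (induction k arbitrary: i j)
    case (Suc k)
    have "(T ^\<^sub>m k) $$ (i, l) * T $$ (l, j) = 0" if "l < N" for l
    proof (cases "l = i \<or> l < i + d")
      case True then show ?thesis using Suc that band by (cases "l = i") auto
    next
      case False
      with Suc.prems have "j < l" by linarith
      then show ?thesis using Suc.prems that band[of l j] by simp
    qed
    then show ?case using Suc.prems by (simp add: step del: pow_mat.simps)
  qed (use T in auto)
  have diag: "(T ^\<^sub>m k) $$ (i, i) = T $$ (i, i) ^ k" if "i < N" for i k
    using that
  proof (induction k arbitrary: i)
    case (Suc k)
    have "(T ^\<^sub>m k) $$ (i, l) * T $$ (l, i) = 0" if "l < N" "l \<noteq> i" for l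
    proof (cases "l < i + d")
      case True then show ?thesis using Suc that off by auto
    next
      case False
      then show ?thesis using Suc.prems that band[of l i] by simp
    qed
    then have "(\<Sum>l<N. (T ^\<^sub>m k) $$ (i, l) * T $$ (l, i)) = (\<Sum>l\<in>{i}. (T ^\<^sub>m k) $$ (i, l) * T $$ (l, i))"
      using Suc.prems by (intro sum.mono_neutral_right) auto
    then show ?case using Suc by (simp add: step mult.commute del: pow_mat.simps)
  qed (use T in auto)
  show "i < N \<Longrightarrow> j < N \<Longrightarrow> i \<noteq> j \<Longrightarrow> j < i + d \<Longrightarrow> (T ^\<^sub>m k) $$ (i, j) = 0"
    and "i < N \<Longrightarrow> (T ^\<^sub>m k) $$ (i, i) = T $$ (i, i) ^ k"
    using off diag by auto
  show "(T ^\<^sub>m k) $$ (i, i + d) = of_nat k * s ^ (k - 1) * T $$ (i, i + d)"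
    if "i + d < N" and s: "\<And>i. i < N \<Longrightarrow> T $$ (i, i) = s"
    using that(1)
  proof (induction k)
    case (Suc k)
    \<comment> \<open>Leaving column \<open>i\<close> costs at least \<open>d\<close> columns, so
      only the middle indices \<open>i\<close> (jump in the last factor) and \<open>i + d\<close>
      (jump before it) contribute.\<close>
    have "(T ^\<^sub>m k) $$ (i, l) * T $$ (l, i + d) = 0" if "l < N" "l \<noteq> i" "l \<noteq> i + d" for l
    proof (cases "l < i + d")
      case True then show ?thesis using Suc that off by auto
    next
      case False
      then show ?thesis using Suc.prems that band[of l "i+d"] \<open>d > 0\<close> by simp
    qed
    then have "(\<Sum>l<N. (T ^\<^sub>m k) $$ (i, l) * T $$ (l, i + d))
        = (\<Sum>l\<in>{i, i + d}. (T ^\<^sub>m k) $$ (i, l) * T $$ (l, i + d))"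
      using Suc.prems by (intro sum.mono_neutral_right) auto
    also have "\<dots> = s ^ k * T $$ (i, i + d) + of_nat k * s ^ (k - 1) * T $$ (i, i + d) * s"
      using Suc diag s \<open>d > 0\<close> by simp
    \<comment> \<open>The truncated exponent \<open>k - 1\<close> does no harm at
      \<open>k = 0\<close>, where the factor \<open>of_nat k\<close> vanishes.\<close>
    also have "\<dots> = of_nat (Suc k) * s ^ k * T $$ (i, i + d)"
      by (cases k) (simp_all add: algebra_simps)
    finally show ?case using Suc.prems by (simp add: step del: pow_mat.simps)
  qed (use T \<open>d > 0\<close> in auto)
qed

section \<open>Complex matrices of finite order and the size of their trace\<close>

lemma complex_eq_1_if_Re_eq_1:
  assumes "cmod z = 1" "Re z = 1"
  shows "z = 1"
  using assms cmod_power2[of z] by (simp add: complex_eq_iff)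

text \<open>A Schur form \<open>T\<close> of \<open>A\<close> keeps the trace and the equation for
  the \<open>n\<close>-th power, so its diagonal consists of roots of unity and the bound is the
  triangle inequality. In the case of equality the diagonal is constant, and the first nonzero
  superdiagonal would survive in the \<open>n\<close>-th power, multiplied by
  \<open>n * s ^ (n - 1)\<close>, which is nonzero. So \<open>T\<close>, and with it
  \<open>A\<close>, is scalar.\<close>

lemma finite_order_scalar_if_trace_maximal:
  fixes A :: "complex mat"
  assumes A: "A \<in> carrier_mat N N" and "n > 0" and An: "A ^\<^sub>m n = 1\<^sub>m N"
  shows "cmod (mat_trace A) \<le> N"
    and "cmod (mat_trace A) = N \<Longrightarrow> A = (mat_trace A / of_nat N) \<cdot>\<^sub>m 1\<^sub>m N"
proof -
  obtain as where "char_poly A = (\<Prod>a\<leftarrow>as. [:- a, 1:])"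
    using char_poly_factorized[OF A] by blast
  from schur_decomposition_exists[OF A this]
  obtain T P Q where T: "T \<in> carrier_mat N N" "upper_triangular T" and wit: "similar_mat_wit A T P Q"
    by (auto simp: similar_mat_def)
  note D = similar_mat_witD2[OF A wit]
  have TnPQ: "similar_mat_wit (T ^\<^sub>m n) (A ^\<^sub>m n) Q P"
    by (rule similar_mat_wit_sym[OF similar_mat_wit_pow[OF wit]])
  have "T ^\<^sub>m n = Q * A ^\<^sub>m n * P"
    by (rule similar_mat_witD(3)[OF refl TnPQ])
  then have Tn: "T ^\<^sub>m n = 1\<^sub>m N"
    unfolding An using right_mult_one_mat[OF D(7)] D(2) by simp
  have tri: "T $$ (i, j) = 0" if "i < N" "j < N" "i \<noteq> j" "j < i + 1" for i j
    using that T by (auto simp: upper_triangular_def)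
  have root_1: "T $$ (i, i) ^ n = 1" if "i < N" for i
  proof -
    have "(T ^\<^sub>m n) $$ (i, i) = T $$ (i, i) ^ n"
      by (rule banded_pow_mat(2)[where N = N and d = 1]) (use T(1) tri that in auto)
    then show ?thesis using Tn that by simp
  qed
  have one: "cmod (T $$ (i, i)) = 1" if "i < N" for i
  proof -
    have "cmod (T $$ (i, i)) ^ n = 1 ^ n"
      using root_1[OF that] by (simp flip: norm_power)
    then show ?thesis by (rule power_eq_imp_eq_base) (use \<open>n > 0\<close> in auto)
  qed
  have tr: "mat_trace A = (\<Sum>i<N. T $$ (i, i))"
    using mat_trace_similar[OF wit] T by (simp add: mat_trace_def)
  show "cmod (mat_trace A) \<le> N"
    unfolding tr by (rule order_trans[OF norm_sum]) (simp add: one)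
  assume max: "cmod (mat_trace A) = N"
  show "A = (mat_trace A / of_nat N) \<cdot>\<^sub>m 1\<^sub>m N"
  proof (cases "N = 0")
    case False
    \<comment> \<open>\<open>s\<close> is the mean of the eigenvalues. Equality puts it on the unit
      circle, and division by it leaves \<open>N\<close> numbers of modulus 1 with sum
      \<open>N\<close>, which are compared through their real parts.\<close>
    define s where "s = mat_trace A / of_nat N"
    have s1: "cmod s = 1" using max False by (simp add: s_def norm_divide)
    then have s0: "s \<noteq> 0" by auto
    have le: "Re (T $$ (i, i) / s) \<le> 1" if "i < N" for i
      using complex_Re_le_cmod[of "T $$ (i, i) / s"] one[OF that] s1 by (simp add: norm_divide)
    have "(\<Sum>i<N. T $$ (i, i) / s) = mat_trace A / s"
      unfolding tr by (simp add: sum_divide_distrib)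
    also have "\<dots> = of_nat N"
      using False s0 by (simp add: s_def)
    finally have "(\<Sum>i<N. T $$ (i, i) / s) = of_nat N" .
    then have sum_zero: "(\<Sum>i<N. 1 - Re (T $$ (i, i) / s)) = 0"
      by (simp add: sum_subtractf flip: Re_sum)
    have Re1: "Re (T $$ (i, i) / s) = 1" if "i < N" for i
    proof -
      have "1 - Re (T $$ (i, i) / s) = 0"
        by (rule sum_nonneg_0[OF _ _ sum_zero]) (use le that in auto)
      then show ?thesis by simp
    qed
    have diag: "T $$ (i, i) = s" if "i < N" for i
    proof -
      have "cmod (T $$ (i, i) / s) = 1" using one[OF that] s1 by (simp add: norm_divide)
      then have "T $$ (i, i) / s = 1" by (rule complex_eq_1_if_Re_eq_1) (rule Re1[OF that])
      then show ?thesis using s0 by simp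
    qed
    have band: "\<forall>i j. i < N \<longrightarrow> j < N \<longrightarrow> i \<noteq> j \<longrightarrow> j < i + d \<longrightarrow> T $$ (i, j) = 0" if "d > 0" for d
      using that
    proof (induction d rule: nat_induct_non_zero)
      case 1
      show ?case using tri by simp
    next
      case (Suc d)
      have new: "T $$ (i, i + d) = 0" if "i + d < N" for i
      proof -
        have "(T ^\<^sub>m n) $$ (i, i + d) = of_nat n * s ^ (n - 1) * T $$ (i, i + d)"
        proof (rule banded_pow_mat(3)[where N = N])
          show "T $$ (i, j) = 0" if "i < N" "j < N" "i \<noteq> j" "j < i + d" for i j
            using Suc.IH that by blast
        qed (use T(1) Suc.hyps diag that in auto)
        then show ?thesis using Tn that s0 \<open>n > 0\<close> \<open>0 < d\<close> by simp
      qed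
      show ?case
      proof (intro allI impI)
        fix i j assume "i < N" "j < N" "i \<noteq> j" "j < i + Suc d"
        then show "T $$ (i, j) = 0"
          using Suc.IH new[of i] by (cases "j = i + d") auto
      qed
    qed
    \<comment> \<open>For \<open>d = N\<close> the band contains every off-diagonal
      position.\<close>
    have "T = s \<cdot>\<^sub>m 1\<^sub>m N"
      using T diag band[of N] by (intro eq_matI) auto
    with D(3) have "A = P * (s \<cdot>\<^sub>m 1\<^sub>m N) * Q" by metis
    also have "P * (s \<cdot>\<^sub>m 1\<^sub>m N) = s \<cdot>\<^sub>m P"
      by (simp add: mult_smult_distrib[OF D(6) one_carrier_mat] right_mult_one_mat[OF D(6)])
    also have "\<dots> * Q = s \<cdot>\<^sub>m 1\<^sub>m N"
      by (simp add: mult_smult_assoc_mat[OF D(6) D(7)] D(1))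
    finally show ?thesis by (simp add: s_def)
  qed (use A in auto)
qed

section \<open>Sums and products of algebraic integers\<close>

text \<open>\<open>x\<close> is an eigenvalue of the integer matrix \<open>c\<close>.\<close>

lemma algebraic_int_if_stable_span:
  fixes x :: "'a::field_char_0" and v :: "'i \<Rightarrow> 'a" and c :: "'i \<Rightarrow> 'i \<Rightarrow> int"
  assumes "finite I" and eq: "\<And>i. i \<in> I \<Longrightarrow> x * v i = (\<Sum>j\<in>I. of_int (c i j) * v j)"
    and "i\<^sub>0 \<in> I" "v i\<^sub>0 \<noteq> 0"
  shows "algebraic_int x"
proof -
  define N where "N = card I"
  obtain e where e: "bij_betw e {..<N} I"
    using ex_bij_betw_nat_finite[OF \<open>finite I\<close>] by (auto simp: N_def atLeast0LessThan)
  define A where "A = mat N N (\<lambda>(k, l). c (e k) (e l))"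
  have A: "A \<in> carrier_mat N N" by (simp add: A_def)
  define w where "w = vec N (\<lambda>k. v (e k))"
  obtain k where k: "k < N" "e k = i\<^sub>0" using e assms by (auto simp: bij_betw_def)
  have "eigenvector (map_mat of_int A) w x"
    unfolding eigenvector_def
  proof (intro conjI)
    show "w \<in> carrier_vec (dim_row (map_mat of_int A))" by (simp add: w_def A_def)
    have "w $ k \<noteq> 0\<^sub>v (dim_row (map_mat of_int A)) $ k"
      using k assms by (simp add: w_def A_def)
    then show "w \<noteq> 0\<^sub>v (dim_row (map_mat of_int A))" by metis
    show "map_mat of_int A *\<^sub>v w = x \<cdot>\<^sub>v w"
    proof (rule eq_vecI)
      fix i assume "i < dim_vec (x \<cdot>\<^sub>v w)"
      then have i: "i < N" by (simp add: w_def)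
      then have "e i \<in> I" using e by (auto simp: bij_betw_def)
      have "(map_mat of_int A *\<^sub>v w) $ i = (\<Sum>l<N. of_int (c (e i) (e l)) * v (e l))"
        using i by (simp add: A_def w_def scalar_prod_def atLeast0LessThan)
      also have "\<dots> = x * v (e i)"
        unfolding eq[OF \<open>e i \<in> I\<close>] by (rule sum.reindex_bij_betw[OF e])
      finally show "(map_mat of_int A *\<^sub>v w) $ i = (x \<cdot>\<^sub>v w) $ i"
        using i by (simp add: w_def)
    qed (simp add: A_def w_def)
  qed
  then have "eigenvalue (map_mat of_int A) x" by (auto simp: eigenvalue_def)
  then have "poly (char_poly (map_mat of_int A)) x = 0"
    by (subst (asm) eigenvalue_root_char_poly[where n = N]) (use A in auto)
  then have "poly (map_poly of_int (char_poly A)) x = 0"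
    by (simp add: of_int_hom.char_poly_hom[OF A])
  then show ?thesis
    unfolding algebraic_int_altdef_ipoly using degree_monic_char_poly[OF A] by auto
qed

text \<open>A monic integer equation rewrites \<open>x ^ m\<close> in lower powers, so the first
  \<open>m\<close> powers span a finitely generated group stable under multiplication by
  \<open>x\<close>; \<open>p\<close> is a companion matrix.\<close>

lemma algebraic_int_powers:
  fixes x :: "'a::field_char_0"
  assumes "algebraic_int x"
  obtains m :: nat and p :: "nat \<Rightarrow> nat \<Rightarrow> int"
  where "m > 0" "\<And>i. i < m \<Longrightarrow> x * x ^ i = (\<Sum>k<m. of_int (p i k) * x ^ k)"
proof -
  obtain q :: "int poly" where q: "poly (map_poly of_int q) x = 0" "lead_coeff q = 1"
    using assms by (auto simp: algebraic_int_altdef_ipoly)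
  define m where "m = degree q"
  have "m > 0"
  proof (rule ccontr)
    assume "\<not> m > 0"
    then obtain c where "q = [:c:]" by (auto simp: m_def elim: degree_eq_zeroE)
    with q show False by simp
  qed
  have "degree (map_poly of_int q :: 'a poly) = m" by (simp add: m_def)
  then have "(\<Sum>k\<le>m. of_int (coeff q k) * x ^ k) = 0"
    using q(1) by (simp add: poly_altdef coeff_map_poly)
  then have top: "x ^ m = (\<Sum>k<m. of_int (- coeff q k) * x ^ k)"
    using q(2) by (simp add: m_def sum_negf eq_neg_iff_add_eq_0 add.commute flip: lessThan_Suc_atMost)
  show ?thesis
  proof (rule that[OF \<open>m > 0\<close>])
    fix i assume "i < m"
    show "x * x ^ i = (\<Sum>k<m. of_int (if Suc i < m then of_bool (k = Suc i) else - coeff q k) * x ^ k)"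
    proof (cases "Suc i < m")
      case True
      then show ?thesis
        by (simp add: of_bool_def if_distrib[of of_int] if_distrib[of "\<lambda>c. c * _"] cong: if_cong)
    next
      case False
      with \<open>i < m\<close> have "Suc i = m" by simp
      then have "x * x ^ i = x ^ m" by (metis power_Suc)
      then show ?thesis unfolding top by (simp add: False)
    qed
  qed
qed

text \<open>The products \<open>x ^ i * y ^ j\<close> with \<open>i < m\<close> and
  \<open>j < n\<close> span a finitely generated group stable under multiplication by
  \<open>x\<close> and by \<open>y\<close>, hence by their sum and product. It contains 1, which
  supplies the nonzero entry of the eigenvector.\<close>

lemma
  fixes x y :: "'a::field_char_0"
  assumes "algebraic_int x" "algebraic_int y"
  shows algebraic_int_add: "algebraic_int (x + y)"
    and algebraic_int_mult: "algebraic_int (x * y)"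
proof -
  obtain m :: nat and p :: "nat \<Rightarrow> nat \<Rightarrow> int" where m: "m > 0"
    and p: "\<And>i. i < m \<Longrightarrow> x * x ^ i = (\<Sum>k<m. of_int (p i k) * x ^ k)"
    using algebraic_int_powers[OF assms(1)] by blast
  obtain n :: nat and q :: "nat \<Rightarrow> nat \<Rightarrow> int" where n: "n > 0"
    and q: "\<And>i. i < n \<Longrightarrow> y * y ^ i = (\<Sum>k<n. of_int (q i k) * y ^ k)"
    using algebraic_int_powers[OF assms(2)] by blast
  define I where "I = {..<m} \<times> {..<n}"
  define v where "v = (\<lambda>(i, j). x ^ i * y ^ j)"
  have I: "finite I" "(0, 0) \<in> I" "v (0, 0) \<noteq> 0" using m n by (auto simp: I_def v_def)
  have prod: "(\<Sum>(k, l)\<in>I. f k * g l) = (\<Sum>k<m. f k) * (\<Sum>l<n. g l)" for f g :: "nat \<Rightarrow> 'a"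
    by (simp add: I_def sum_product sum.cartesian_product)
  show "algebraic_int (x * y)"
  \<comment> \<open>The matrix of multiplication by \<open>x * y\<close> is the Kronecker product of
    those of \<open>x\<close> and \<open>y\<close>.\<close>
  proof (rule algebraic_int_if_stable_span[where v = v and c = "\<lambda>(i, j) (k, l). p i k * q j l", OF I(1) _ I(2,3)])
    fix ij assume "ij \<in> I"
    then obtain i j where ij: "ij = (i, j)" "i < m" "j < n" by (auto simp: I_def)
    have "(\<Sum>kl\<in>I. of_int ((case ij of (i, j) \<Rightarrow> \<lambda>(k, l). p i k * q j l) kl) * v kl)
        = (\<Sum>(k, l)\<in>I. (of_int (p i k) * x ^ k) * (of_int (q j l) * y ^ l))"
      by (intro sum.cong) (auto simp: ij v_def)
    also have "\<dots> = (x * x ^ i) * (y * y ^ j)"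
      unfolding prod using p q ij by simp
    finally show "x * y * v ij = (\<Sum>kl\<in>I. of_int ((case ij of (i, j) \<Rightarrow> \<lambda>(k, l). p i k * q j l) kl) * v kl)"
      by (simp add: ij v_def)
  qed
  show "algebraic_int (x + y)"
  \<comment> \<open>For the sum it is the Kronecker sum, with \<open>of_bool\<close> giving the
    entries of identity matrices.\<close>
  proof (rule algebraic_int_if_stable_span[where v = v and
        c = "\<lambda>(i, j) (k, l). p i k * of_bool (l = j) + of_bool (k = i) * q j l", OF I(1) _ I(2,3)])
    fix ij assume "ij \<in> I"
    then obtain i j where ij: "ij = (i, j)" "i < m" "j < n" by (auto simp: I_def)
    have *: "(\<Sum>k<m. of_bool (k = i) * x ^ k) = x ^ i" "(\<Sum>l<n. of_bool (l = j) * y ^ l) = y ^ j"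
      using ij by (auto simp: of_bool_def if_distrib[of "\<lambda>c. c * _"] cong: if_cong)
    have "(\<Sum>kl\<in>I. of_int ((case ij of (i, j) \<Rightarrow>
              \<lambda>(k, l). p i k * of_bool (l = j) + of_bool (k = i) * q j l) kl) * v kl)
        = (\<Sum>(k, l)\<in>I. (of_int (p i k) * x ^ k) * (of_bool (l = j) * y ^ l))
        + (\<Sum>(k, l)\<in>I. (of_bool (k = i) * x ^ k) * (of_int (q j l) * y ^ l))"
      unfolding sum.distrib[symmetric]
      by (intro sum.cong) (auto simp: ij v_def algebra_simps)
    also have "\<dots> = (x * x ^ i) * y ^ j + x ^ i * (y * y ^ j)"
      unfolding prod * using p q ij by simp
    finally show "(x + y) * v ij = (\<Sum>kl\<in>I. of_int ((case ij of (i, j) \<Rightarrow>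
              \<lambda>(k, l). p i k * of_bool (l = j) + of_bool (k = i) * q j l) kl) * v kl)"
      by (simp add: ij v_def algebra_simps)
  qed
qed

section \<open>Conjugates of algebraic numbers\<close>

text \<open>A homomorphism from a subfield \<open>K\<close>, carried by a total function of which
  only the values on \<open>K\<close> are constrained. With domains as sets, adjoining elements one
  by one stays within a single type. Closure under inverses includes
  \<open>inverse 0 = 0\<close>.\<close>

locale partial_embedding =
  fixes K :: "'a::field_char_0 set" and \<sigma> :: "'a \<Rightarrow> 'b::field_char_0"
  assumes one_mem: "1 \<in> K"
    and diff_mem: "x \<in> K \<Longrightarrow> y \<in> K \<Longrightarrow> x - y \<in> K"
    and mult_mem: "x \<in> K \<Longrightarrow> y \<in> K \<Longrightarrow> x * y \<in> K"
    and inverse_mem: "x \<in> K \<Longrightarrow> inverse x \<in> K"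
    and emb_one: "\<sigma> 1 = 1"
    and emb_add: "x \<in> K \<Longrightarrow> y \<in> K \<Longrightarrow> \<sigma> (x + y) = \<sigma> x + \<sigma> y"
    and emb_mult: "x \<in> K \<Longrightarrow> y \<in> K \<Longrightarrow> \<sigma> (x * y) = \<sigma> x * \<sigma> y"
begin

lemma zero_mem: "0 \<in> K"
  using diff_mem[OF one_mem one_mem] by simp

lemma uminus_mem: "x \<in> K \<Longrightarrow> - x \<in> K"
  using diff_mem[OF zero_mem] by simp

lemma add_mem: "x \<in> K \<Longrightarrow> y \<in> K \<Longrightarrow> x + y \<in> K"
  using diff_mem[of x "- y"] uminus_mem by simp

lemma divide_mem: "x \<in> K \<Longrightarrow> y \<in> K \<Longrightarrow> x / y \<in> K"
  using mult_mem inverse_mem by (simp add: divide_inverse)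

lemma power_mem: "x \<in> K \<Longrightarrow> x ^ n \<in> K"
  by (induction n) (auto intro: one_mem mult_mem)

lemma sum_mem: "(\<And>i. i \<in> I \<Longrightarrow> f i \<in> K) \<Longrightarrow> sum f I \<in> K"
  by (induction I rule: infinite_finite_induct) (auto intro: zero_mem add_mem)

lemma of_nat_mem: "of_nat n \<in> K"
  by (induction n) (auto intro: zero_mem one_mem add_mem)

lemma of_int_mem: "of_int n \<in> K"
  using of_nat_mem uminus_mem by (cases n) (auto simp del: of_nat_Suc)

lemma emb_zero: "\<sigma> 0 = 0"
  using emb_add[OF zero_mem zero_mem] by simp

lemma emb_uminus: "x \<in> K \<Longrightarrow> \<sigma> (- x) = - \<sigma> x"
  using emb_add[of x "- x"] uminus_mem emb_zero by (simp add: eq_neg_iff_add_eq_0 add.commute)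

lemma emb_diff: "x \<in> K \<Longrightarrow> y \<in> K \<Longrightarrow> \<sigma> (x - y) = \<sigma> x - \<sigma> y"
  using emb_add[of x "- y"] emb_uminus uminus_mem by simp

lemma emb_power: "x \<in> K \<Longrightarrow> \<sigma> (x ^ n) = \<sigma> x ^ n"
  by (induction n) (auto simp: emb_one emb_mult power_mem)

lemma emb_sum: "(\<And>i. i \<in> I \<Longrightarrow> f i \<in> K) \<Longrightarrow> \<sigma> (sum f I) = (\<Sum>i\<in>I. \<sigma> (f i))"
  by (induction I rule: infinite_finite_induct) (auto simp: emb_zero emb_add sum_mem)

lemma emb_of_nat: "\<sigma> (of_nat n) = of_nat n"
  by (induction n) (auto simp: emb_zero emb_one emb_add of_nat_mem one_mem)

lemma emb_of_int: "\<sigma> (of_int n) = of_int n"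
  by (cases n) (auto simp: emb_of_nat emb_uminus of_nat_mem simp del: of_nat_Suc)

lemma emb_eq_0_iff: "x \<in> K \<Longrightarrow> \<sigma> x = 0 \<longleftrightarrow> x = 0"
  using emb_mult[of x "inverse x"] inverse_mem[of x] emb_one emb_zero by (cases "x = 0") auto

lemma emb_eq_iff: "x \<in> K \<Longrightarrow> y \<in> K \<Longrightarrow> \<sigma> x = \<sigma> y \<longleftrightarrow> x = y"
  using emb_eq_0_iff[OF diff_mem, of x y] by (simp add: emb_diff)

section \<open>The polynomial ring over \<open>K\<close>: arithmetic, transport along
  \<open>\<sigma>\<close>, division with remainder\<close>

definition polys :: "'a poly set" where
  "polys = {p. \<forall>i. coeff p i \<in> K}"

lemma polysD: "p \<in> polys \<Longrightarrow> coeff p i \<in> K"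
  by (simp add: polys_def)

lemma pCons_mem_polys_iff: "pCons c p \<in> polys \<longleftrightarrow> c \<in> K \<and> p \<in> polys"
  by (auto simp: polys_def coeff_pCons split: nat.splits)

lemma zero_polys: "0 \<in> polys"
  by (simp add: polys_def zero_mem)

lemma add_polys: "p \<in> polys \<Longrightarrow> q \<in> polys \<Longrightarrow> p + q \<in> polys"
  by (simp add: polys_def add_mem)

lemma diff_polys: "p \<in> polys \<Longrightarrow> q \<in> polys \<Longrightarrow> p - q \<in> polys"
  by (simp add: polys_def diff_mem)

lemma mult_polys: "p \<in> polys \<Longrightarrow> q \<in> polys \<Longrightarrow> p * q \<in> polys"
  by (auto simp: polys_def coeff_mult intro!: sum_mem mult_mem)

lemma const_polys: "c \<in> K \<Longrightarrow> [:c:] \<in> polys"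
  by (simp add: pCons_mem_polys_iff zero_polys)

lemma map_poly_add: "p \<in> polys \<Longrightarrow> q \<in> polys \<Longrightarrow> map_poly \<sigma> (p + q) = map_poly \<sigma> p + map_poly \<sigma> q"
  by (intro poly_eqI) (simp add: coeff_map_poly emb_zero emb_add polysD)

lemma map_poly_diff: "p \<in> polys \<Longrightarrow> q \<in> polys \<Longrightarrow> map_poly \<sigma> (p - q) = map_poly \<sigma> p - map_poly \<sigma> q"
  by (intro poly_eqI) (simp add: coeff_map_poly emb_zero emb_diff polysD)

lemma map_poly_mult: "p \<in> polys \<Longrightarrow> q \<in> polys \<Longrightarrow> map_poly \<sigma> (p * q) = map_poly \<sigma> p * map_poly \<sigma> q"
  by (intro poly_eqI) (simp add: coeff_map_poly emb_zero coeff_mult emb_sum emb_mult mult_mem polysD)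

lemma degree_map_poly_emb: "p \<in> polys \<Longrightarrow> degree (map_poly \<sigma> p) = degree p"
  by (cases "p = 0") (auto intro!: map_poly_degree_eq simp: emb_eq_0_iff polysD)

lemma poly_mem:
  assumes "p \<in> polys" "x \<in> K"
  shows "poly p x \<in> K"
  using assms by (induction p) (auto simp: pCons_mem_polys_iff intro: zero_mem add_mem mult_mem)

lemma emb_poly:
  assumes "p \<in> polys" "x \<in> K"
  shows "\<sigma> (poly p x) = poly (map_poly \<sigma> p) (\<sigma> x)"
  using assms
  by (induction p)
     (auto simp: pCons_mem_polys_iff map_poly_pCons emb_zero emb_add emb_mult mult_mem poly_mem)

text \<open>Only the leading coefficient of \<open>g\<close> is ever inverted, so quotient and
  remainder keep their coefficients in \<open>K\<close>.\<close>

lemma polys_division: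
  assumes "g \<in> polys" "g \<noteq> 0" "p \<in> polys"
  obtains s r where "s \<in> polys" "r \<in> polys" "p = g * s + r" "r = 0 \<or> degree r < degree g"
proof -
  have "\<exists>s r. s \<in> polys \<and> r \<in> polys \<and> p = g * s + r \<and> (r = 0 \<or> degree r < degree g)"
    using assms(3)
  proof (induction p)
    case 0
    show ?case using zero_polys by (intro exI[of _ 0]) simp
  next
    case (pCons a p)
    then obtain s r where sr: "s \<in> polys" "r \<in> polys" "p = g * s + r" "r = 0 \<or> degree r < degree g"
      by (auto simp: pCons_mem_polys_iff)
    \<comment> \<open>One step of long division: \<open>pCons a r\<close> has degree at most that of
      \<open>g\<close>, and \<open>c\<close> is the quotient digit that cancels its coefficient at
      this degree.\<close>
    define c where "c = coeff (pCons a r) (degree g) / lead_coeff g"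
    define r' where "r' = pCons a r - g * [:c:]"
    have ar: "pCons a r \<in> polys" using pCons.prems sr by (simp add: pCons_mem_polys_iff)
    then have c: "c \<in> K" unfolding c_def using assms by (intro divide_mem polysD)
    have r': "r' \<in> polys" unfolding r'_def using assms ar c by (intro diff_polys mult_polys const_polys)
    have "degree (pCons a r) \<le> degree g" using sr(4) by auto
    then have "degree r' \<le> degree g" unfolding r'_def by (intro degree_diff_le) auto
    moreover have "coeff r' (degree g) = 0" using assms(2) by (simp add: r'_def c_def)
    ultimately have "r' = 0 \<or> degree r' < degree g" by (rule eq_zero_or_degree_less)
    moreover have "pCons a p = g * (pCons 0 s + [:c:]) + r'"
      by (simp add: r'_def sr(3) algebra_simps)
    moreover have "pCons 0 s + [:c:] \<in> polys"
      using sr c zero_mem by (intro add_polys const_polys) (simp_all add: pCons_mem_polys_iff)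
    ultimately show ?case using r' by blast
  qed
  with that show thesis by blast
qed

section \<open>Minimal polynomials over \<open>K\<close> and the adjunction of a root\<close>

definition min_poly :: "'a \<Rightarrow> 'a poly \<Rightarrow> bool" where
  "min_poly y p \<longleftrightarrow> p \<in> polys \<and> p \<noteq> 0 \<and> poly p y = 0 \<and>
     (\<forall>q\<in>polys. q \<noteq> 0 \<longrightarrow> poly q y = 0 \<longrightarrow> degree p \<le> degree q)"

lemma min_poly_exists:
  assumes "algebraic y"
  obtains p where "min_poly y p"
proof -
  obtain q where q: "\<And>i. coeff q i \<in> \<int>" "q \<noteq> 0" "poly q y = 0"
    using assms by (rule algebraicE) blast
  have "coeff q i \<in> K" for i
    using q(1)[of i] of_int_mem by (auto elim: Ints_cases)
  then have "q \<in> polys" by (simp add: polys_def)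
  with q have "q \<in> polys \<and> q \<noteq> 0 \<and> poly q y = 0" by simp
  from ex_has_least_nat[of "\<lambda>q. q \<in> polys \<and> q \<noteq> 0 \<and> poly q y = 0", OF this, of degree]
  show thesis using that unfolding min_poly_def by blast
qed

lemma min_polyD:
  assumes "min_poly y p"
  shows "p \<in> polys" "p \<noteq> 0" "poly p y = 0"
    and "\<And>q. q \<in> polys \<Longrightarrow> q \<noteq> 0 \<Longrightarrow> poly q y = 0 \<Longrightarrow> degree p \<le> degree q"
  using assms unfolding min_poly_def by blast+

lemma min_poly_degree_pos: "min_poly y p \<Longrightarrow> degree p > 0"
  using min_polyD[of y p] by (auto intro!: Nat.gr0I elim: degree_eq_zeroE)

lemma min_poly_dvd:
  assumes p: "min_poly y p" and q: "q \<in> polys" "poly q y = 0"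
  obtains s where "s \<in> polys" "q = p * s"
proof -
  obtain s r where sr: "s \<in> polys" "r \<in> polys" "q = p * s + r" "r = 0 \<or> degree r < degree p"
    using polys_division[OF min_polyD(1,2)[OF p] q(1)] .
  have "poly r y = 0" using q(2) min_polyD(3)[OF p] by (simp add: sr(3))
  with min_polyD(4)[OF p sr(2)] sr(4) have "r = 0" by fastforce
  with sr(1,3) that show thesis by simp
qed

text \<open>Makes \<open>K[y]\<close> a field, by the Euclidean algorithm.\<close>

lemma min_poly_inverse:
  assumes p: "min_poly y p" and "q \<in> polys" "poly q y \<noteq> 0"
  shows "\<exists>t\<in>polys. poly q y * poly t y = 1"
proof -
  note pD = min_polyD[OF p]
  \<comment> \<open>Below the degree of \<open>p\<close> the inverse is found by descent: dividing
    \<open>p\<close> by \<open>q\<close> gives \<open>poly r y = - (poly q y * poly s y)\<close>, so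
    an inverse of \<open>poly r y\<close> yields one of \<open>poly q y\<close>.\<close>
  have small: "\<exists>t\<in>polys. poly q y * poly t y = 1"
    if "q \<in> polys" "q \<noteq> 0" "degree q < degree p" for q
    using that
  proof (induction "degree q" arbitrary: q rule: less_induct)
    case less
    obtain s r where sr: "s \<in> polys" "r \<in> polys" "p = q * s + r" "r = 0 \<or> degree r < degree q"
      using polys_division[OF less.prems(1,2) pD(1)] .
    have eq: "poly q y * poly s y + poly r y = 0"
      using pD(3) by (simp add: sr(3))
    show ?case
    proof (cases "r = 0")
      case True
      \<comment> \<open>By minimality \<open>poly q y\<close> is nonzero, so the cofactor
        \<open>s\<close> vanishes at \<open>y\<close> and has at least the degree of
        \<open>p\<close>, which leaves \<open>q\<close> constant.\<close>
      then have ps: "p = q * s" using sr(3) by simp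
      then have "s \<noteq> 0" using pD(2) by auto
      have "poly q y \<noteq> 0" using pD(4) less.prems by fastforce
      with eq True have "poly s y = 0" by simp
      then have "degree p \<le> degree s" using pD(4) sr(1) \<open>s \<noteq> 0\<close> by blast
      moreover have "degree p = degree q + degree s"
        unfolding ps using \<open>s \<noteq> 0\<close> less.prems(2) by (simp add: degree_mult_eq)
      ultimately have "degree q = 0" by linarith
      then obtain c where c: "q = [:c:]" by (rule degree_eq_zeroE)
      with less.prems(1,2) have "c \<in> K" "c \<noteq> 0" by (auto simp: pCons_mem_polys_iff)
      then show ?thesis unfolding c
        by (intro bexI[of _ "[:inverse c:]"] const_polys inverse_mem) simp_all
    next
      case False
      with sr(4) have "degree r < degree q" by simp
      with less.hyps[OF this sr(2) False] less.prems(3)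
      obtain t where t: "t \<in> polys" "poly r y * poly t y = 1" by auto
      have "poly q y * poly s y = - poly r y" using eq by (simp add: eq_neg_iff_add_eq_0)
      moreover have "poly q y * poly (0 - s * t) y = - (poly q y * poly s y) * poly t y" by simp
      ultimately have "poly q y * poly (0 - s * t) y = 1" using t(2) by simp
      then show ?thesis using t(1) sr(1) by (intro bexI[of _ "0 - s * t"] diff_polys mult_polys zero_polys)
    qed
  qed
  obtain s r where sr: "s \<in> polys" "r \<in> polys" "q = p * s + r" "r = 0 \<or> degree r < degree p"
    using polys_division[OF pD(1,2) assms(2)] .
  have r: "poly q y = poly r y" by (simp add: sr(3) pD(3))
  with assms(3) have "r \<noteq> 0" by auto
  with small[OF sr(2)] sr(4) show ?thesis unfolding r by blast
qed

text \<open>The extension sends \<open>poly q y\<close> to the value at \<open>w\<close> of the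
  transported \<open>q\<close>. This does not depend on \<open>q\<close>, because the polynomials
  vanishing at \<open>y\<close> are multiples of \<open>p\<close>, and the transport of
  \<open>p\<close> vanishes at \<open>w\<close>.\<close>

theorem extend_to_root:
  assumes p: "min_poly y p" and w: "poly (map_poly \<sigma> p) w = 0"
  obtains K' and \<sigma>' :: "'a \<Rightarrow> 'b" where "partial_embedding K' \<sigma>'" "K \<subseteq> K'"
    "\<And>x. x \<in> K \<Longrightarrow> \<sigma>' x = \<sigma> x" "y \<in> K'" "\<sigma>' y = w"
proof -
  have wd: "poly (map_poly \<sigma> q) w = poly (map_poly \<sigma> q') w"
    if q: "q \<in> polys" "q' \<in> polys" "poly q y = poly q' y" for q q'
  proof -
    obtain s where "s \<in> polys" "q - q' = p * s"
      using min_poly_dvd[OF p diff_polys[OF q(1,2)]] q(3) by auto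
    then have "map_poly \<sigma> q - map_poly \<sigma> q' = map_poly \<sigma> p * map_poly \<sigma> s"
      using map_poly_diff[OF q(1,2)] map_poly_mult[of p s] p by (simp add: min_poly_def)
    then have "poly (map_poly \<sigma> q - map_poly \<sigma> q') w = 0" using w by simp
    then show ?thesis by simp
  qed
  define K' where "K' = (\<lambda>q. poly q y) ` polys"
  define \<sigma>' where "\<sigma>' z = poly (map_poly \<sigma> (SOME q. q \<in> polys \<and> z = poly q y)) w" for z
  have \<sigma>': "\<sigma>' (poly q y) = poly (map_poly \<sigma> q) w" if "q \<in> polys" for q
  proof -
    have "(SOME q'. q' \<in> polys \<and> poly q y = poly q' y) \<in> polys \<and>
        poly q y = poly (SOME q'. q' \<in> polys \<and> poly q y = poly q' y) y"
      by (rule someI[of _ q]) (simp add: that)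
    then show ?thesis unfolding \<sigma>'_def by (intro wd) (use that in auto)
  qed
  show thesis
  proof (rule that)
    show "K \<subseteq> K'"
      unfolding K'_def using const_polys by force
    show "\<sigma>' x = \<sigma> x" if "x \<in> K" for x
      using \<sigma>'[OF const_polys[OF that]]
      by (cases "x = 0") (simp_all add: map_poly_pCons emb_zero)
    have X: "[:0, 1:] \<in> polys" by (simp add: pCons_mem_polys_iff zero_polys zero_mem one_mem)
    then show "y \<in> K'" unfolding K'_def by force
    show "\<sigma>' y = w" using \<sigma>'[OF X] by (simp add: map_poly_pCons emb_zero emb_one)
    show "partial_embedding K' \<sigma>'"
    proof
      show "1 \<in> K'" using \<open>K \<subseteq> K'\<close> one_mem by auto
      show "\<sigma>' 1 = 1" using \<open>\<And>x. x \<in> K \<Longrightarrow> \<sigma>' x = \<sigma> x\<close>[OF one_mem] emb_one by simp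
    next
      fix x z assume "x \<in> K'" "z \<in> K'"
      then obtain q r where qr: "q \<in> polys" "r \<in> polys" "x = poly q y" "z = poly r y"
        by (auto simp: K'_def)
      show "x - z \<in> K'" unfolding K'_def
        by (rule image_eqI[of _ _ "q - r"]) (simp_all add: qr diff_polys)
      show "x * z \<in> K'" unfolding K'_def
        by (rule image_eqI[of _ _ "q * r"]) (simp_all add: qr mult_polys)
      show "\<sigma>' (x + z) = \<sigma>' x + \<sigma>' z"
        using \<sigma>'[OF add_polys[OF qr(1,2)]] \<sigma>' qr by (simp add: map_poly_add)
      show "\<sigma>' (x * z) = \<sigma>' x * \<sigma>' z"
        using \<sigma>'[OF mult_polys[OF qr(1,2)]] \<sigma>' qr by (simp add: map_poly_mult)
    next
      fix x assume "x \<in> K'"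
      then obtain q where q: "q \<in> polys" "x = poly q y" by (auto simp: K'_def)
      show "inverse x \<in> K'"
      proof (cases "x = 0")
        case True
        then show ?thesis using \<open>K \<subseteq> K'\<close> zero_mem by auto
      next
        case False
        then obtain t where "t \<in> polys" "x * poly t y = 1"
          using min_poly_inverse[OF p q(1)] q(2) by auto
        then show ?thesis unfolding K'_def by (metis imageI inverse_unique)
      qed
    qed
  qed
qed

end

text \<open>One element is adjoined at a time. Its minimal polynomial keeps its positive degree
  under transport, so it acquires a root in the algebraically closed target, and this root can serve
  as image.\<close>

lemma partial_embedding_extend_finite:
  fixes \<sigma> :: "'a::field_char_0 \<Rightarrow> 'b::{alg_closed_field, field_char_0}"
  assumes "partial_embedding K \<sigma>" "finite T" "\<And>y. y \<in> T \<Longrightarrow> algebraic y"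
  obtains K' and \<sigma>' :: "'a \<Rightarrow> 'b" where "partial_embedding K' \<sigma>'" "K \<subseteq> K'" "T \<subseteq> K'"
    "\<And>x. x \<in> K \<Longrightarrow> \<sigma>' x = \<sigma> x"
proof -
  have "\<exists>K' \<sigma>' :: 'a \<Rightarrow> 'b. partial_embedding K' \<sigma>' \<and> K \<subseteq> K' \<and> T \<subseteq> K' \<and> (\<forall>x\<in>K. \<sigma>' x = \<sigma> x)"
    using assms(2,3)
  proof (induction T)
    case empty
    then show ?case using assms(1) by blast
  next
    case (insert y T)
    then obtain K' and \<sigma>' :: "'a \<Rightarrow> 'b" where IH: "partial_embedding K' \<sigma>'" "K \<subseteq> K'" "T \<subseteq> K'"
      "\<forall>x\<in>K. \<sigma>' x = \<sigma> x" by blast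
    interpret partial_embedding K' \<sigma>' by fact
    obtain p where p: "min_poly y p" using min_poly_exists insert.prems by blast
    then have "degree (map_poly \<sigma>' p) > 0"
      using degree_map_poly_emb min_poly_degree_pos min_polyD(1)[OF p] p by auto
    then obtain w where "poly (map_poly \<sigma>' p) w = 0" using alg_closed_imp_poly_has_root by blast
    then obtain K'' and \<sigma>'' :: "'a \<Rightarrow> 'b" where "partial_embedding K'' \<sigma>''" "K' \<subseteq> K''"
      "\<And>x. x \<in> K' \<Longrightarrow> \<sigma>'' x = \<sigma>' x" "y \<in> K''"
      using extend_to_root[OF p] by metis
    with IH show ?case by (intro exI[of _ K''] exI[of _ \<sigma>'']) auto
  qed
  with that show thesis by blast
qed

section \<open>Embeddings over the rationals and the size of conjugates\<close>

lemma partial_embedding_Rats: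
  "partial_embedding (\<rat> :: 'a::field_char_0 set) (\<lambda>x. of_rat (inv_into UNIV of_rat x) :: 'b::field_char_0)"
proof -
  have [simp]: "inv_into UNIV of_rat (of_rat r :: 'a) = r" for r
    by (rule inv_f_f) (simp add: inj_on_def)
  show ?thesis
  proof
    show "of_rat (inv_into UNIV of_rat (1 :: 'a)) = (1 :: 'b)"
      using \<open>inv_into UNIV of_rat (of_rat 1 :: 'a) = 1\<close> by simp
  qed (auto elim!: Rats_cases simp flip: of_rat_add of_rat_mult)
qed

text \<open>Once \<open>a\<close> is split off, the remaining factors have a product of norm at most
  1, so \<open>a\<close> alone must carry the lower bound.\<close>

lemma prod_mset_norm_ge_1:
  fixes A :: "'b::real_normed_field multiset"
  assumes "\<And>a. a \<in># A \<Longrightarrow> norm a \<le> 1" "1 \<le> norm (prod_mset A)" "a \<in># A"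
  shows "norm a = 1"
proof -
  obtain B where B: "A = add_mset a B" using assms(3) by (metis insert_DiffM)
  have "norm (prod_mset C) \<le> 1" if "\<And>a. a \<in># C \<Longrightarrow> norm a \<le> 1" for C :: "'b multiset"
    using that by (induction C) (auto simp: norm_mult mult_le_one)
  from this[of B] have "norm (prod_mset B) \<le> 1" using assms(1) B by simp
  then have "norm a * norm (prod_mset B) \<le> norm a" by (intro mult_left_le) auto
  with assms(2) B have "1 \<le> norm a" by (simp add: norm_mult)
  with assms show ?thesis by (simp add: order_antisym)
qed

text \<open>Every complex root of the rational minimal polynomial of \<open>\<alpha>\<close> is the
  value at \<open>\<alpha>\<close> of an embedding defined on all of \<open>T\<close>, so
  \<open>le\<close> bounds these roots by 1. Their product is a nonzero rational integer up to sign,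
  so none of them can be smaller than 1 in modulus. \<open>T\<close> collects the further numbers on
  which the embedding has to be defined.\<close>

theorem some_conjugate_norm_1:
  fixes \<alpha> :: "'a::field_char_0"
  assumes "algebraic_int \<alpha>" "\<alpha> \<noteq> 0" "finite T" "\<And>y. y \<in> T \<Longrightarrow> algebraic y"
    and le: "\<And>K (\<sigma> :: 'a \<Rightarrow> complex). partial_embedding K \<sigma> \<Longrightarrow> \<alpha> \<in> K \<Longrightarrow> T \<subseteq> K \<Longrightarrow> cmod (\<sigma> \<alpha>) \<le> 1"
  obtains K and \<sigma> :: "'a \<Rightarrow> complex"
  where "partial_embedding K \<sigma>" "\<alpha> \<in> K" "T \<subseteq> K" "cmod (\<sigma> \<alpha>) = 1"
proof -
  let ?\<tau> = "\<lambda>x :: 'a. of_rat (inv_into UNIV of_rat x) :: complex"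
  interpret partial_embedding "\<rat>" ?\<tau> by (rule partial_embedding_Rats)
  obtain p where p: "min_poly \<alpha> p" using min_poly_exists assms(1) by blast
  then have pK: "p \<in> polys" by (simp add: min_poly_def)
  define f where "f = map_poly ?\<tau> p"
  have degf: "degree f > 0"
    using degree_map_poly_emb[OF pK] min_poly_degree_pos[OF p] by (simp add: f_def)
  \<comment> \<open>First \<open>\<alpha>\<close> is sent to \<open>w\<close>, then the elements of
    \<open>T\<close> are adjoined; the second extension keeps the value at
    \<open>\<alpha>\<close>.\<close>
  have conj: "\<exists>K (\<sigma> :: 'a \<Rightarrow> complex). partial_embedding K \<sigma> \<and> \<alpha> \<in> K \<and> T \<subseteq> K \<and> \<sigma> \<alpha> = w"
    if w: "poly f w = 0" for w
  proof -
    obtain K1 and \<sigma>1 :: "'a \<Rightarrow> complex" where 1: "partial_embedding K1 \<sigma>1" "\<alpha> \<in> K1" "\<sigma>1 \<alpha> = w"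
      using extend_to_root[OF p w[unfolded f_def]] by blast
    obtain K2 and \<sigma>2 :: "'a \<Rightarrow> complex" where "partial_embedding K2 \<sigma>2" "K1 \<subseteq> K2" "T \<subseteq> K2"
      "\<And>x. x \<in> K1 \<Longrightarrow> \<sigma>2 x = \<sigma>1 x"
      using partial_embedding_extend_finite[OF 1(1) assms(3,4)] by blast
    with 1 show ?thesis by (intro exI[of _ K2] exI[of _ \<sigma>2]) auto
  qed
  have root: "algebraic_int w \<and> w \<noteq> 0 \<and> cmod w \<le> 1" if w: "poly f w = 0" for w
  proof -
    obtain K and \<sigma> :: "'a \<Rightarrow> complex" where \<sigma>: "partial_embedding K \<sigma>" "\<alpha> \<in> K" "T \<subseteq> K" "\<sigma> \<alpha> = w"
      using conj[OF w] by blast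
    interpret S: partial_embedding K \<sigma> by fact
    \<comment> \<open>Integers are fixed by \<open>\<sigma>\<close>, so \<open>w\<close> is a root
      of the same monic integer polynomial \<open>q\<close> as \<open>\<alpha>\<close>.\<close>
    obtain q where q: "poly (map_poly of_int q) \<alpha> = 0" "lead_coeff q = 1"
      using assms(1) by (auto simp: algebraic_int_altdef_ipoly)
    have "map_poly of_int q \<in> S.polys" by (simp add: S.polys_def coeff_map_poly S.of_int_mem)
    from S.emb_poly[OF this \<sigma>(2)] have "poly (map_poly \<sigma> (map_poly of_int q)) w = 0"
      using q \<sigma> S.emb_zero by simp
    also have "map_poly \<sigma> (map_poly of_int q) = map_poly of_int q"
      by (intro poly_eqI) (simp add: coeff_map_poly S.emb_zero S.emb_of_int)
    finally have "algebraic_int w" using q by (auto simp: algebraic_int_altdef_ipoly)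
    moreover have "w \<noteq> 0" using \<sigma> S.emb_eq_0_iff assms(2) by auto
    moreover have "cmod w \<le> 1" using le[OF \<sigma>(1-3)] \<sigma>(4) by simp
    ultimately show ?thesis by blast
  qed
  have f0: "f \<noteq> 0" using degf by auto
  obtain A where A: "size A = degree f" "f = smult (lead_coeff f) (\<Prod>x\<in>#A. [:- x, 1:])"
    using alg_closed_imp_factorization[OF f0] by blast
  have rootA: "poly f a = 0" if "a \<in># A" for a
    using that by (subst A(2)) (auto simp: poly_prod_mset prod_mset_zero_iff)
  have coeffQ: "coeff f i \<in> \<rat>" for i by (simp add: f_def coeff_map_poly emb_zero)
  \<comment> \<open>Vieta, with a division because \<open>f\<close> is not normalized to be monic:
    the product of the negated roots is a quotient of rational coefficients.\<close>
  have "poly f 0 = lead_coeff f * (\<Prod>x\<in>#A. - x)"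
    by (subst A(2)) (simp add: poly_prod_mset image_mset.compositionality o_def)
  then have "(\<Prod>x\<in>#A. - x) = coeff f 0 / lead_coeff f"
    using f0 by (simp add: poly_0_coeff_0)
  then have Q: "(\<Prod>x\<in>#A. - x) \<in> \<rat>" using coeffQ by simp
  have "algebraic_int (\<Prod>x\<in>#B. - x) \<and> (\<Prod>x\<in>#B. - x) \<noteq> 0" if "B \<subseteq># A" for B
    using that
  proof (induction B)
    case (add x B)
    then have "x \<in># A" "B \<subseteq># A"
      by (auto simp: insert_subset_eq_iff intro: subset_mset.order_trans[OF _ diff_subset_eq_self])
    with root[OF rootA, of x] add.IH show ?case by (auto intro!: algebraic_int_mult)
  qed (auto intro: int_imp_algebraic_int)
  from this[of A] have P: "algebraic_int (\<Prod>x\<in>#A. - x)" "(\<Prod>x\<in>#A. - x) \<noteq> 0" by auto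
  obtain z where z: "(\<Prod>x\<in>#A. - x) = of_int z"
    using rational_algebraic_int_is_int[OF P(1) Q] by (rule Ints_cases)
  with P(2) have "z \<noteq> 0" by (metis of_int_0)
  then have "1 \<le> cmod (\<Prod>x\<in>#A. - x)" unfolding z by simp
  moreover have "A \<noteq> {#}" using A(1) degf by auto
  then obtain a where a: "a \<in># A" by blast
  ultimately have "cmod (- a) = 1"
    using root[OF rootA] by (intro prod_mset_norm_ge_1[where A = "image_mset uminus A"]) auto
  with conj[OF rootA[OF a]] that show thesis by auto
qed

section \<open>The ring of integers and its twisted group ring\<close>

lemma ring_of_integers_simps [simp]:
  "carrier (ring_of_integers F) = {x \<in> F. algebraic_int x}"
  "x \<otimes>\<^bsub>ring_of_integers F\<^esub> y = x * y"
  "x \<oplus>\<^bsub>ring_of_integers F\<^esub> y = x + y"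
  "\<zero>\<^bsub>ring_of_integers F\<^esub> = 0"
  "\<one>\<^bsub>ring_of_integers F\<^esub> = 1"
  by (simp_all add: ring_of_integers_def ring_of_type_algebra_def)

lemma number_field_closed:
  assumes "number_field F"
  shows "0 \<in> F" "1 \<in> F" "x \<in> F \<Longrightarrow> y \<in> F \<Longrightarrow> x + y \<in> F" "x \<in> F \<Longrightarrow> y \<in> F \<Longrightarrow> x * y \<in> F"
proof -
  have "subring F ring_of_type_algebra"
    using assms by (simp add: number_field_def subfield_def subdomain_def subcring_def)
  from subringE[OF this] show "0 \<in> F" "1 \<in> F"
    "x \<in> F \<Longrightarrow> y \<in> F \<Longrightarrow> x + y \<in> F" "x \<in> F \<Longrightarrow> y \<in> F \<Longrightarrow> x * y \<in> F"
    by (simp_all add: ring_of_type_algebra_def)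
qed

context
  fixes F :: "'a::field_char_0 set"
  assumes F: "number_field F"
begin

lemma abelian_monoid_ring_of_integers: "abelian_monoid (ring_of_integers F)"
  by (rule abelian_monoidI)
     (auto simp: number_field_closed[OF F] algebraic_int_add add.assoc add.commute)

lemma comm_monoid_ring_of_integers: "comm_monoid (ring_of_integers F)"
  by (rule comm_monoidI)
     (auto simp: number_field_closed[OF F] algebraic_int_mult int_imp_algebraic_int mult.assoc mult.commute)

lemma finsum_ring_of_integers:
  assumes "f \<in> A \<rightarrow> carrier (ring_of_integers F)"
  shows "finsum (ring_of_integers F) f A = sum f A"
proof -
  interpret abelian_monoid "ring_of_integers F" by (rule abelian_monoid_ring_of_integers)
  show ?thesis
    using assms
  proof (induction A rule: infinite_finite_induct)
    case (infinite A)
    \<comment> \<open>On an infinite index set both sums default to zero.\<close>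
    then show ?case by (simp add: finsum_infinite)
  next
    case empty
    show ?case by simp
  next
    case (insert a A)
    then have "finsum (ring_of_integers F) f (insert a A) = f a + finsum (ring_of_integers F) f A"
      by (subst finsum_insert) auto
    with insert show ?case by auto
  qed
qed

lemma power_mem_ring_of_integers:
  "x \<in> carrier (ring_of_integers F) \<Longrightarrow> x ^ n \<in> carrier (ring_of_integers F)"
  by (induction n)
     (auto simp: number_field_closed[OF F] algebraic_int_mult int_imp_algebraic_int)

lemma root_of_unity_mem_Units:
  assumes "x \<in> carrier (ring_of_integers F)" "x ^ n = 1" "n > 0"
  shows "x \<in> Units (ring_of_integers F)"
proof -
  have "x * x ^ (n - 1) = 1"
    using assms(2,3) by (metis power_minus_mult mult.commute)
  then show ?thesis
    using assms(1) power_mem_ring_of_integers[OF assms(1), of "n - 1"]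
    unfolding Units_def by (auto simp: mult.commute intro!: bexI[of _ "x ^ (n - 1)"])
qed

lemma inv_units_of_ring_of_integers:
  assumes "x \<in> Units (ring_of_integers F)"
  shows "x \<noteq> 0" "inv\<^bsub>units_of (ring_of_integers F)\<^esub> x = inverse x"
proof -
  interpret comm_monoid "ring_of_integers F" by (rule comm_monoid_ring_of_integers)
  have "x * inv\<^bsub>units_of (ring_of_integers F)\<^esub> x = 1"
    using group.r_inv[OF units_group] assms by (simp add: units_of_def)
  then show "x \<noteq> 0" "inv\<^bsub>units_of (ring_of_integers F)\<^esub> x = inverse x"
    by (auto simp: inverse_unique)
qed

text \<open>A member of the class \<open>c\<close> is a coboundary times a cocycle \<open>z\<close>.
  On both sides of the identity the coboundary contributes \<open>l g * l h * l k\<close> divided by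
  the value of \<open>l\<close> at the product of the three elements, so the identity for
  \<open>z\<close> carries over.\<close>

lemma H2_representative:
  assumes "Group.group G" "c \<in> carrier (H2 G (units_of (ring_of_integers F)))" "\<beta> \<in> c"
    and "g \<in> carrier G" "h \<in> carrier G" "k \<in> carrier G"
  shows "\<beta> (g, h) \<in> carrier (ring_of_integers F)"
    and "\<beta> (g, h) * \<beta> (g \<otimes>\<^bsub>G\<^esub> h, k) = \<beta> (h, k) * \<beta> (g, h \<otimes>\<^bsub>G\<^esub> k)"
proof -
  interpret R: comm_monoid "ring_of_integers F" by (rule comm_monoid_ring_of_integers)
  interpret group G by fact
  let ?U = "units_of (ring_of_integers F)"
  have U: "carrier ?U = Units (ring_of_integers F)" "\<And>x y. x \<otimes>\<^bsub>?U\<^esub> y = x * y"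
    by (simp_all add: units_of_def)
  obtain z l where z: "z \<in> carrier (cocycles2 G ?U)" and l: "l \<in> carrier G \<rightarrow> carrier ?U"
    and \<beta>: "\<beta> = coboundary2 G ?U l \<otimes>\<^bsub>cocycles2 G ?U\<^esub> z"
    using assms(2,3) by (auto simp: H2_def FactGroup_def RCOSETS_def r_coset_def)
  have zU: "z (g, h) \<in> Units (ring_of_integers F)" if "g \<in> carrier G" "h \<in> carrier G" for g h
    using z that U by (auto simp: cocycles2_def PiE_def Pi_def)
  have lU: "l g \<in> Units (ring_of_integers F)" if "g \<in> carrier G" for g
    using l that U by auto
  have eq: "\<beta> (g, h) = l g * l h * inverse (l (g \<otimes>\<^bsub>G\<^esub> h)) * z (g, h)"
    if "g \<in> carrier G" "h \<in> carrier G" for g h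
    using that lU inv_units_of_ring_of_integers
    by (simp add: \<beta> cocycles2_def coboundary2_def U)
  have inv: "inverse x \<in> carrier (ring_of_integers F)" if "x \<in> Units (ring_of_integers F)" for x
    using group.inv_closed[OF R.units_group, of x] that inv_units_of_ring_of_integers[OF that] U
      R.Units_closed by metis
  have "\<beta> (g, h) = l g \<otimes>\<^bsub>ring_of_integers F\<^esub> l h \<otimes>\<^bsub>ring_of_integers F\<^esub> inverse (l (g \<otimes>\<^bsub>G\<^esub> h)) \<otimes>\<^bsub>ring_of_integers F\<^esub> z (g, h)"
    using eq[OF assms(4,5)] by simp
  then show "\<beta> (g, h) \<in> carrier (ring_of_integers F)"
    using assms(4,5) by (metis R.Units_closed R.m_closed inv lU zU m_closed)
  have "z (g, h) * z (g \<otimes>\<^bsub>G\<^esub> h, k) = z (h, k) * z (g, h \<otimes>\<^bsub>G\<^esub> k)"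
    using z assms(4-6) U by (auto simp: cocycles2_def)
  moreover have "l (g \<otimes>\<^bsub>G\<^esub> h) \<noteq> 0" "l (h \<otimes>\<^bsub>G\<^esub> k) \<noteq> 0"
    using inv_units_of_ring_of_integers(1) lU assms(4-6) by auto
  ultimately show "\<beta> (g, h) * \<beta> (g \<otimes>\<^bsub>G\<^esub> h, k) = \<beta> (h, k) * \<beta> (g, h \<otimes>\<^bsub>G\<^esub> k)"
    using assms(4-6) by (simp add: eq m_assoc field_simps)
qed

text \<open>Addition is pointwise and the term of index \<open>g\<close> is supported at
  \<open>g\<close> alone. This passes from an expansion in the basis to the coefficient function,
  with which the rest of the argument works.\<close>

lemma finsum_twisted_group_ring_basis:
  fixes G :: "('g, 'm) monoid_scheme" and \<beta> :: "'g \<times> 'g \<Rightarrow> 'a"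
  assumes "finite (carrier G)" "a \<in> carrier G \<rightarrow> carrier (ring_of_integers F)"
  defines "S \<equiv> twisted_group_ring (ring_of_integers F) G \<beta>"
  shows "(\<Oplus>\<^bsub>S\<^esub>g\<in>carrier G. a g \<odot>\<^bsub>S\<^esub> tgr_basis (ring_of_integers F) G g) = restrict a (carrier G)"
proof -
  have basis_term: "a g \<odot>\<^bsub>S\<^esub> tgr_basis (ring_of_integers F) G g = (\<lambda>h\<in>carrier G. if h = g then a g else 0)" for g
    by (auto simp: S_def twisted_group_ring_def tgr_basis_def)
  interpret abelian_monoid S
    by (rule abelian_monoidI)
       (auto simp: S_def twisted_group_ring_def PiE_def extensional_def algebraic_int_add
          number_field_closed[OF F] fun_eq_iff restrict_def Pi_def)
  have "(\<Oplus>\<^bsub>S\<^esub>g\<in>A. a g \<odot>\<^bsub>S\<^esub> tgr_basis (ring_of_integers F) G g)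
      = (\<lambda>h\<in>carrier G. if h \<in> A then a h else 0)" if "finite A" "A \<subseteq> carrier G" for A
    using that
  proof (induction A)
    case empty
    show ?case unfolding finsum_empty by (simp add: S_def twisted_group_ring_def)
  next
    case (insert g A)
    have mem: "a g \<odot>\<^bsub>S\<^esub> tgr_basis (ring_of_integers F) G g \<in> carrier S" if "g \<in> carrier G" for g
      using that assms(2) number_field_closed(1)[OF F]
      by (auto simp: basis_term) (auto simp: S_def twisted_group_ring_def)
    have IH: "(\<Oplus>\<^bsub>S\<^esub>g\<in>A. a g \<odot>\<^bsub>S\<^esub> tgr_basis (ring_of_integers F) G g)
        = (\<lambda>h\<in>carrier G. if h \<in> A then a h else 0)"
      by (rule insert.IH) (use insert.prems in auto)
    have "(\<Oplus>\<^bsub>S\<^esub>g\<in>insert g A. a g \<odot>\<^bsub>S\<^esub> tgr_basis (ring_of_integers F) G g)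
        = a g \<odot>\<^bsub>S\<^esub> tgr_basis (ring_of_integers F) G g
          \<oplus>\<^bsub>S\<^esub> (\<Oplus>\<^bsub>S\<^esub>g\<in>A. a g \<odot>\<^bsub>S\<^esub> tgr_basis (ring_of_integers F) G g)"
      by (rule finsum_insert) (use insert.hyps insert.prems mem in auto)
    also have "\<dots> = (\<lambda>h\<in>carrier G. if h = g then a g else 0)
          \<oplus>\<^bsub>S\<^esub> (\<lambda>h\<in>carrier G. if h \<in> A then a h else 0)"
      by (subst IH) (simp only: basis_term)
    also have "\<dots> = (\<lambda>h\<in>carrier G. if h \<in> insert g A then a h else 0)"
      using insert.hyps by (auto simp: S_def twisted_group_ring_def fun_eq_iff restrict_def)
    finally show ?case .
  qed
  from this[OF assms(1) subset_refl] show ?thesis by (auto simp: fun_eq_iff restrict_def)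
qed

end

section \<open>The regular representation of a twisted group algebra\<close>

locale twisting = group G for G :: "('g, 'm) monoid_scheme" (structure) +
  fixes \<beta> :: "'g \<times> 'g \<Rightarrow> 'a::field_char_0"
  assumes finite_carrier: "finite (carrier G)"
    and cocycle: "g \<in> carrier G \<Longrightarrow> h \<in> carrier G \<Longrightarrow> k \<in> carrier G \<Longrightarrow>
      \<beta> (g, h) * \<beta> (g \<otimes> h, k) = \<beta> (h, k) * \<beta> (g, h \<otimes> k)"
    and left_normalized: "g \<in> carrier G \<Longrightarrow> \<beta> (\<one>, g) = 1"
    and right_normalized: "g \<in> carrier G \<Longrightarrow> \<beta> (g, \<one>) = 1"
begin

text \<open>The coefficient at \<open>k\<close> of a product in the twisted group ring, with the
  factorizations of \<open>k\<close> parametrized by their right factor \<open>l\<close>.\<close>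

definition twisted_conv :: "('g \<Rightarrow> 'a) \<Rightarrow> ('g \<Rightarrow> 'a) \<Rightarrow> 'g \<Rightarrow> 'a" where
  "twisted_conv y z k = (\<Sum>l\<in>carrier G. y (k \<otimes> inv l) * z l * \<beta> (k \<otimes> inv l, l))"

text \<open>The coefficient of \<open>u\<^sub>k\<close> in \<open>y u\<^sub>h\<close>.\<close>

definition regular_coeff :: "('g \<Rightarrow> 'a) \<Rightarrow> 'g \<Rightarrow> 'g \<Rightarrow> 'a" where
  "regular_coeff y k h = y (k \<otimes> inv h) * \<beta> (k \<otimes> inv h, h)"

lemma sum_factorizations:
  assumes "k \<in> carrier G"
  shows "(\<Sum>(g, h)\<in>{(g, h) \<in> carrier G \<times> carrier G. g \<otimes> h = k}. y g * z h * \<beta> (g, h))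
    = twisted_conv y z k"
  unfolding twisted_conv_def
  by (rule sum.reindex_bij_witness[of _ "\<lambda>l. (k \<otimes> inv l, l)" snd])
     (use assms in \<open>auto simp: m_assoc inv_solve_right\<close>)

text \<open>This is associativity of the twisted product in coordinates,
  \<open>(y z) u_h = y (z u_h)\<close>, and so the place where the cocycle identity enters.\<close>

lemma regular_coeff_conv:
  assumes "k \<in> carrier G" "h \<in> carrier G"
  shows "regular_coeff (twisted_conv y z) k h
    = (\<Sum>l\<in>carrier G. regular_coeff y k l * regular_coeff z l h)"
proof -
  have "twisted_conv y z (k \<otimes> inv h)
      = (\<Sum>l\<in>carrier G. y (k \<otimes> inv l) * z (l \<otimes> inv h) * \<beta> (k \<otimes> inv l, l \<otimes> inv h))"
    unfolding twisted_conv_def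
  proof (rule sum.reindex_bij_witness[of _ "\<lambda>l. l \<otimes> inv h" "\<lambda>m. m \<otimes> h"])
    fix m assume m: "m \<in> carrier G"
    have "k \<otimes> inv h \<otimes> inv m = k \<otimes> inv (m \<otimes> h)" "m \<otimes> h \<otimes> inv h = m"
      using m assms by (simp_all add: inv_mult_group m_assoc)
    then show "y (k \<otimes> inv (m \<otimes> h)) * z (m \<otimes> h \<otimes> inv h) * \<beta> (k \<otimes> inv (m \<otimes> h), m \<otimes> h \<otimes> inv h)
        = y (k \<otimes> inv h \<otimes> inv m) * z m * \<beta> (k \<otimes> inv h \<otimes> inv m, m)"
      by simp
  qed (use assms in \<open>auto simp: m_assoc\<close>)
  then have "regular_coeff (twisted_conv y z) k h
      = (\<Sum>l\<in>carrier G. y (k \<otimes> inv l) * z (l \<otimes> inv h) *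
          (\<beta> (k \<otimes> inv l, l \<otimes> inv h) * \<beta> (k \<otimes> inv h, h)))"
    by (simp add: regular_coeff_def sum_distrib_right mult.assoc)
  also have "\<dots> = (\<Sum>l\<in>carrier G. regular_coeff y k l * regular_coeff z l h)"
  proof (rule sum.cong[OF refl])
    fix l assume l: "l \<in> carrier G"
    have "k \<otimes> inv l \<otimes> (l \<otimes> inv h) = k \<otimes> inv h" "l \<otimes> inv h \<otimes> h = l"
      using l assms by (simp_all add: m_assoc) (simp add: m_assoc[symmetric])
    then have "\<beta> (k \<otimes> inv l, l \<otimes> inv h) * \<beta> (k \<otimes> inv h, h) = \<beta> (l \<otimes> inv h, h) * \<beta> (k \<otimes> inv l, l)"
      using cocycle[of "k \<otimes> inv l" "l \<otimes> inv h" h] l assms by simp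
    then show "y (k \<otimes> inv l) * z (l \<otimes> inv h) * (\<beta> (k \<otimes> inv l, l \<otimes> inv h) * \<beta> (k \<otimes> inv h, h))
        = regular_coeff y k l * regular_coeff z l h"
      by (simp add: regular_coeff_def mult_ac)
  qed
  finally show ?thesis .
qed

text \<open>\<open>w k\<close> stands for the coefficients of the \<open>k\<close>-th power of
  \<open>x\<close>, given by a recursion on \<open>carrier G\<close>. Under the regular
  representation they become the powers of one complex matrix, which has finite order and trace
  \<open>|G|\<close> times the image of \<open>x \<one>\<close>.\<close>

lemma eq_one_coeff_if_finite_order:
  fixes x :: "'g \<Rightarrow> 'a" and w :: "nat \<Rightarrow> 'g \<Rightarrow> 'a"
  assumes int: "\<And>g. g \<in> carrier G \<Longrightarrow> algebraic_int (x g)"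
      "\<And>g h. g \<in> carrier G \<Longrightarrow> h \<in> carrier G \<Longrightarrow> algebraic_int (\<beta> (g, h))"
    and w_0: "\<And>g. g \<in> carrier G \<Longrightarrow> w 0 g = of_bool (g = \<one>)"
    and w_Suc: "\<And>k g. g \<in> carrier G \<Longrightarrow> w (Suc k) g = twisted_conv (w k) x g"
    and w_n: "\<And>g. g \<in> carrier G \<Longrightarrow> w n g = of_bool (g = \<one>)" and "n > 0"
    and nz: "x \<one> \<noteq> 0"
  shows "x \<one> ^ n = 1" and "g \<in> carrier G \<Longrightarrow> g \<noteq> \<one> \<Longrightarrow> x g = 0"
proof -
  define N where "N = card (carrier G)"
  have "N > 0" unfolding N_def using finite_carrier one_closed by (auto simp: card_gt_0_iff)
  obtain e where e: "bij_betw e {..<N} (carrier G)"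
    using ex_bij_betw_nat_finite[OF finite_carrier] by (auto simp: N_def atLeast0LessThan)
  have eG: "e i \<in> carrier G" if "i < N" for i using e that by (auto simp: bij_betw_def)
  have e_inj: "e i = e j \<longleftrightarrow> i = j" if "i < N" "j < N" for i j
    using e that by (auto simp: bij_betw_def inj_on_def)
  \<comment> \<open>\<open>M \<sigma> y\<close> is left multiplication by \<open>y\<close> in the
    basis \<open>u\<close>, with entries carried to the complex numbers by
    \<open>\<sigma>\<close>.\<close>
  define M where "M \<sigma> y = mat N N (\<lambda>(i, j). \<sigma> (regular_coeff y (e i) (e j)) :: complex)" for \<sigma> y
  have M: "M \<sigma> y \<in> carrier_mat N N" for \<sigma> y by (simp add: M_def)
  \<comment> \<open>The entries for all powers of \<open>x\<close> are built from \<open>T\<close>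
    by sums and products, so an embedding defined on \<open>T\<close> transports them all.\<close>
  define T where "T = x ` carrier G \<union> \<beta> ` (carrier G \<times> carrier G)"
  have order: "M \<sigma> x ^\<^sub>m n = 1\<^sub>m N" and trace: "mat_trace (M \<sigma> x) = of_nat N * \<sigma> (x \<one>)"
    if "partial_embedding K \<sigma>" and TK: "T \<subseteq> K" for K and \<sigma> :: "'a \<Rightarrow> complex"
  proof -
    interpret E: partial_embedding K \<sigma> by fact
    have xK: "x g \<in> K" if "g \<in> carrier G" for g using that TK by (auto simp: T_def)
    have \<beta>K: "\<beta> (g, h) \<in> K" if "g \<in> carrier G" "h \<in> carrier G" for g h
      using that TK by (auto simp: T_def)
    have wK: "w k g \<in> K" if "g \<in> carrier G" for k g
      using that
    proof (induction k arbitrary: g)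
      case 0
      then show ?case by (simp add: w_0 E.zero_mem E.one_mem)
    next
      case (Suc k)
      then show ?case
        by (auto simp: w_Suc twisted_conv_def intro!: E.sum_mem E.mult_mem xK \<beta>K)
    qed
    have coeffK: "regular_coeff y g h \<in> K"
      if "\<And>g. g \<in> carrier G \<Longrightarrow> y g \<in> K" "g \<in> carrier G" "h \<in> carrier G" for y g h
      using that \<beta>K by (auto simp: regular_coeff_def intro!: E.mult_mem)
    have unit: "M \<sigma> y = 1\<^sub>m N" if y: "\<And>g. g \<in> carrier G \<Longrightarrow> y g = of_bool (g = \<one>)" for y
    proof (rule eq_matI)
      fix i j assume "i < dim_row (1\<^sub>m N)" "j < dim_col (1\<^sub>m N)"
      then have ij: "i < N" "j < N" by auto
      have "e i \<otimes> inv e j = \<one> \<longleftrightarrow> i = j"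
        using ij eG by (metis e_inj inv_closed inv_equality inv_inv r_inv)
      then show "M \<sigma> y $$ (i, j) = 1\<^sub>m N $$ (i, j)"
        using ij eG y left_normalized
        by (auto simp: M_def regular_coeff_def E.emb_zero E.emb_one)
    qed (simp_all add: M_def)
    have step: "M \<sigma> (w (Suc k)) = M \<sigma> (w k) * M \<sigma> x" for k
    proof (rule eq_matI)
      fix i j assume "i < dim_row (M \<sigma> (w k) * M \<sigma> x)" "j < dim_col (M \<sigma> (w k) * M \<sigma> x)"
      then have ij: "i < N" "j < N" by (auto simp: M_def)
      have "M \<sigma> (w (Suc k)) $$ (i, j) = \<sigma> (regular_coeff (twisted_conv (w k) x) (e i) (e j))"
        using ij eG by (simp add: M_def regular_coeff_def w_Suc)
      also have "\<dots> = (\<Sum>l\<in>carrier G. \<sigma> (regular_coeff (w k) (e i) l) * \<sigma> (regular_coeff x l (e j)))"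
        using ij eG wK xK
        by (simp add: regular_coeff_conv E.emb_sum E.emb_mult E.mult_mem coeffK)
      also have "\<dots> = (\<Sum>l<N. \<sigma> (regular_coeff (w k) (e i) (e l)) * \<sigma> (regular_coeff x (e l) (e j)))"
        by (rule sum.reindex_bij_betw[OF e, symmetric])
      also have "\<dots> = (M \<sigma> (w k) * M \<sigma> x) $$ (i, j)"
        using ij by (simp add: M_def scalar_prod_def atLeast0LessThan)
      finally show "M \<sigma> (w (Suc k)) $$ (i, j) = (M \<sigma> (w k) * M \<sigma> x) $$ (i, j)" .
    qed (simp_all add: M_def)
    have "M \<sigma> (w k) = M \<sigma> x ^\<^sub>m k" for k
    proof (induction k)
      case 0
      show ?case using unit[of "w 0"] w_0 M[of \<sigma> x] by simp
    qed (simp add: step)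
    then show "M \<sigma> x ^\<^sub>m n = 1\<^sub>m N" using unit[of "w n"] w_n by simp
    \<comment> \<open>Each diagonal entry is the image of \<open>x \<one>\<close> times
      \<open>\<beta> (\<one>, e i)\<close>, which is 1.\<close>
    show "mat_trace (M \<sigma> x) = of_nat N * \<sigma> (x \<one>)"
      using eG left_normalized by (simp add: mat_trace_def M_def regular_coeff_def)
  qed
  have finT: "finite T" using finite_carrier by (simp add: T_def)
  have algT: "algebraic y" if "y \<in> T" for y using that int by (auto simp: T_def)
  have le: "cmod (\<sigma> (x \<one>)) \<le> 1"
    if "partial_embedding K \<sigma>" "T \<subseteq> K" for K and \<sigma> :: "'a \<Rightarrow> complex"
    using finite_order_scalar_if_trace_maximal(1)[OF M \<open>n > 0\<close> order[OF that]] \<open>N > 0\<close>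
    by (simp add: trace[OF that] norm_mult)
  obtain K and \<sigma> :: "'a \<Rightarrow> complex" where \<sigma>: "partial_embedding K \<sigma>" "T \<subseteq> K" "cmod (\<sigma> (x \<one>)) = 1"
    using some_conjugate_norm_1[OF int(1)[OF one_closed] nz finT algT] le by metis
  interpret E: partial_embedding K \<sigma> by fact
  have xK: "x g \<in> K" if "g \<in> carrier G" for g using that \<sigma>(2) by (auto simp: T_def)
  have Mx: "M \<sigma> x = \<sigma> (x \<one>) \<cdot>\<^sub>m 1\<^sub>m N"
    using finite_order_scalar_if_trace_maximal(2)[OF M \<open>n > 0\<close> order[OF \<sigma>(1,2)]] \<open>N > 0\<close> \<sigma>(3)
    by (simp add: trace[OF \<sigma>(1,2)] norm_mult)
  have "(M \<sigma> x ^\<^sub>m n) $$ (0, 0) = M \<sigma> x $$ (0, 0) ^ n"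
    by (rule banded_pow_mat(2)[where N = N and d = 1]) (use M Mx \<open>N > 0\<close> in auto)
  then have "\<sigma> (x \<one>) ^ n = 1"
    using order[OF \<sigma>(1,2)] Mx \<open>N > 0\<close> by simp
  \<comment> \<open>Injectivity of \<open>\<sigma>\<close> on \<open>K\<close> brings the equation
    back from the complex numbers.\<close>
  then have "\<sigma> (x \<one> ^ n) = \<sigma> 1" using xK by (simp add: E.emb_power E.emb_one)
  then show "x \<one> ^ n = 1" using xK E.emb_eq_iff E.power_mem E.one_mem by simp
  show "x g = 0" if g: "g \<in> carrier G" "g \<noteq> \<one>"
  proof -
    \<comment> \<open>The column of \<open>\<one>\<close> contains the images of the coefficients of
      \<open>x\<close> themselves, since \<open>\<beta> (g, \<one>) = 1\<close>.\<close>
    obtain i j where ij: "i < N" "e i = g" "j < N" "e j = \<one>"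
      using e g one_closed by (metis bij_betw_imp_surj_on imageE lessThan_iff)
    then have "i \<noteq> j" using g by auto
    then have "M \<sigma> x $$ (i, j) = 0" using ij Mx by simp
    then have "\<sigma> (x g) = 0" using ij g right_normalized by (simp add: M_def regular_coeff_def)
    then show ?thesis using E.emb_eq_0_iff xK g by simp
  qed
qed

end

section \<open>Torsion units of the twisted group ring over the ring of integers\<close>

theorem theorem5p6:
  fixes G :: "('g, 'm) monoid_scheme"
    and F :: "'a::field_char_0 set"
    and R :: "'a ring"
    and c :: "('g \<times> 'g \<Rightarrow> 'a) set"
    and \<beta> :: "'g \<times> 'g \<Rightarrow> 'a"
    and S :: "('a, 'g \<Rightarrow> 'a) module"
    and u :: "'g \<Rightarrow> 'g \<Rightarrow> 'a"
    and a :: "'g \<Rightarrow> 'a"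
    and x :: "'g \<Rightarrow> 'a"
  defines "R \<equiv> ring_of_integers F"
    and "S \<equiv> twisted_group_ring R G \<beta>"
    and "u \<equiv> tgr_basis R G"
  assumes "group G" and "finite (carrier G)"
    and "number_field F"
    and "c \<in> carrier (H2 G (units_of R))"
    and "\<beta> \<in> c" and "normalized_cochain2 G (units_of R) \<beta>"
    and "a \<in> carrier G \<rightarrow> carrier R"
    and "x = (\<Oplus>\<^bsub>S\<^esub>g\<in>carrier G. a g \<odot>\<^bsub>S\<^esub> u g)"
    and "torsion_unit S x"
    and "a \<one>\<^bsub>G\<^esub> \<noteq> \<zero>\<^bsub>R\<^esub>"
  shows "x \<in> (\<lambda>r. r \<odot>\<^bsub>S\<^esub> u \<one>\<^bsub>G\<^esub>) ` Units R"
proof -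
  note F = \<open>number_field F\<close>
  interpret group G by fact
  note \<beta> = H2_representative[OF F \<open>group G\<close> \<open>c \<in> carrier (H2 G (units_of R))\<close>[unfolded R_def] \<open>\<beta> \<in> c\<close>]
  interpret twisting G \<beta>
    using \<open>finite (carrier G)\<close> \<beta>(2) \<open>normalized_cochain2 G (units_of R) \<beta>\<close>
    by unfold_locales (auto simp: normalized_cochain2_def units_of_def R_def)
  have x: "x = restrict a (carrier G)"
    unfolding \<open>x = _\<close> S_def u_def R_def
    using F \<open>finite (carrier G)\<close> \<open>a \<in> _\<close>[unfolded R_def] by (rule finsum_twisted_group_ring_basis)
  have xR: "x g \<in> carrier R" if "g \<in> carrier G" for g
    using that \<open>a \<in> _\<close> by (auto simp: x)
  \<comment> \<open>The \<open>finsum\<close> of \<open>R\<close> turns into an ordinary sum once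
    its terms are known to lie in \<open>R\<close>; hence the conditions on the coefficients of both
    factors.\<close>
  have mult: "(y \<otimes>\<^bsub>S\<^esub> z) k = twisted_conv y z k"
    if "k \<in> carrier G" "\<And>g. g \<in> carrier G \<Longrightarrow> y g \<in> carrier R" "\<And>g. g \<in> carrier G \<Longrightarrow> z g \<in> carrier R"
    for y z k
  proof -
    interpret R: comm_monoid R unfolding R_def by (rule comm_monoid_ring_of_integers[OF F])
    have "(y \<otimes>\<^bsub>S\<^esub> z) k = finsum R (\<lambda>(g, h). y g \<otimes>\<^bsub>R\<^esub> z h \<otimes>\<^bsub>R\<^esub> \<beta> (g, h))
        {(g, h) \<in> carrier G \<times> carrier G. g \<otimes>\<^bsub>G\<^esub> h = k}"
      using that(1) by (simp add: S_def twisted_group_ring_def)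
    also have "\<dots> = sum (\<lambda>(g, h). y g \<otimes>\<^bsub>R\<^esub> z h \<otimes>\<^bsub>R\<^esub> \<beta> (g, h))
        {(g, h) \<in> carrier G \<times> carrier G. g \<otimes>\<^bsub>G\<^esub> h = k}"
      unfolding R_def
    proof (rule finsum_ring_of_integers[OF F], fold R_def)
      have "\<beta> (g, h) \<in> carrier R" if "g \<in> carrier G" "h \<in> carrier G" for g h
        using \<beta>(1)[OF that one_closed] by (simp add: R_def)
      then show "(\<lambda>(g, h). y g \<otimes>\<^bsub>R\<^esub> z h \<otimes>\<^bsub>R\<^esub> \<beta> (g, h))
          \<in> {(g, h) \<in> carrier G \<times> carrier G. g \<otimes>\<^bsub>G\<^esub> h = k} \<rightarrow> carrier R"
        using that(2,3) by (auto intro!: R.m_closed)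
    qed
    also have "\<dots> = twisted_conv y z k"
      using sum_factorizations[OF that(1)] by (simp add: R_def)
    finally show ?thesis .
  qed
  \<comment> \<open>This lets \<open>mult\<close> be applied to the powers of
    \<open>x\<close>.\<close>
  have powR: "(x [^]\<^bsub>S\<^esub> k) g \<in> carrier R" if "g \<in> carrier G" for k :: nat and g
    using that
  proof (induction k arbitrary: g)
    case 0
    then show ?case
      using number_field_closed[OF F]
      by (auto simp: S_def twisted_group_ring_def tgr_basis_def R_def intro: int_imp_algebraic_int)
  next
    case (Suc k)
    interpret A: abelian_monoid R unfolding R_def by (rule abelian_monoid_ring_of_integers[OF F])
    interpret R: comm_monoid R unfolding R_def by (rule comm_monoid_ring_of_integers[OF F])
    have "\<beta> (g, h) \<in> carrier R" if "g \<in> carrier G" "h \<in> carrier G" for g h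
      using \<beta>(1)[OF that one_closed] by (simp add: R_def)
    then have "finsum R (\<lambda>(g, h). (x [^]\<^bsub>S\<^esub> k) g \<otimes>\<^bsub>R\<^esub> x h \<otimes>\<^bsub>R\<^esub> \<beta> (g, h))
        {(g', h) \<in> carrier G \<times> carrier G. g' \<otimes>\<^bsub>G\<^esub> h = g} \<in> carrier R"
      using Suc.IH xR by (intro A.finsum_closed) (auto intro!: R.m_closed)
    then show ?case using Suc.prems by (simp add: S_def twisted_group_ring_def)
  qed
  obtain n :: nat where n: "n > 0" "x [^]\<^bsub>S\<^esub> n = \<one>\<^bsub>S\<^esub>"
    using \<open>torsion_unit S x\<close> by (auto simp: torsion_unit_def)
  have one: "\<one>\<^bsub>S\<^esub> g = of_bool (g = \<one>\<^bsub>G\<^esub>)" if "g \<in> carrier G" for g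
    using that by (simp add: S_def twisted_group_ring_def tgr_basis_def R_def)
  have intx: "algebraic_int (x g)" if "g \<in> carrier G" for g
    using xR[OF that] by (simp add: R_def)
  have int\<beta>: "algebraic_int (\<beta> (g, h))" if "g \<in> carrier G" "h \<in> carrier G" for g h
    using \<beta>(1)[OF that one_closed] by simp
  have nz: "x \<one>\<^bsub>G\<^esub> \<noteq> 0" using \<open>a \<one>\<^bsub>G\<^esub> \<noteq> \<zero>\<^bsub>R\<^esub>\<close> by (simp add: x R_def)
  have pow_Suc: "(x [^]\<^bsub>S\<^esub> Suc k) g = twisted_conv (x [^]\<^bsub>S\<^esub> k) x g" if "g \<in> carrier G" for k g
    using mult[OF that powR xR] by simp
  have pow_0: "(x [^]\<^bsub>S\<^esub> (0::nat)) g = of_bool (g = \<one>\<^bsub>G\<^esub>)" if "g \<in> carrier G" for g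
    using one[OF that] by simp
  have pow_n: "(x [^]\<^bsub>S\<^esub> n) g = of_bool (g = \<one>\<^bsub>G\<^esub>)" if "g \<in> carrier G" for g
    using one[OF that] n(2) by simp
  note key = eq_one_coeff_if_finite_order[where w = "\<lambda>k. x [^]\<^bsub>S\<^esub> k" and n = n and x = x]
  have root: "x \<one>\<^bsub>G\<^esub> ^ n = 1"
    by (rule key(1)) (fact intx int\<beta> pow_0 pow_Suc pow_n n(1) nz)+
  have zero: "x g = 0" if "g \<in> carrier G" "g \<noteq> \<one>\<^bsub>G\<^esub>" for g
    by (rule key(2)) (fact intx int\<beta> pow_0 pow_Suc pow_n n(1) nz that)+
  have "x \<one>\<^bsub>G\<^esub> \<in> Units R"
    unfolding R_def by (rule root_of_unity_mem_Units[OF F _ root n(1)]) (use xR[OF one_closed] in \<open>simp add: R_def\<close>)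
  \<comment> \<open>Under the identification of \<open>R\<close> with \<open>R u_1\<close>,
    \<open>x\<close> is its only surviving coefficient.\<close>
  moreover have "x = x \<one>\<^bsub>G\<^esub> \<odot>\<^bsub>S\<^esub> u \<one>\<^bsub>G\<^esub>"
    using zero by (auto simp: x fun_eq_iff S_def twisted_group_ring_def u_def tgr_basis_def R_def restrict_def)
  ultimately show ?thesis by blast
qed

end
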